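(* Let $A\subseteq \mathbb{Z}$ and $1\leq p\leq \infty$. Then the characteristic function $\chi_A:\mathbb{Z}\to\{0,1\}$ of $A$ satisfies \[ \|(\mathcal{M}\chi_A)''\|_p \leq 2^{1-\frac{1}{p}}\,3^{\frac{1}{p}}\,\|\chi_A''\|_p, \] where $\mathcal{M}$ is the discrete noncentered Hardy-Littlewood maximal operator and $''$ denotes the discrete second derivative.
   Context: Let $\mathbb{Z}^+$ denote the nonnegative integers (including $0$). For a function $f:\mathbb{Z}\to\mathbb{R}$ and $r,s\in\mathbb{Z}^+$, the discrete noncentered averages are \[ \mathcal{A}_{r,s}f(n):=\frac{1}{r+s+1}\sum_{j=-r}^{s}|f(n+j)|, \qquad n\in\mathbb{Z}, \] and the discrete noncentered Hardy-Littlewood maximal function is \[ \mathcal{M}f(n):=\sup_{r,s\in\mathbb{Z}^+}\mathcal{A}_{r,s}f(n). \] The discrete second derivative of $f:\mathbb{Z}\to\mathbb{R}$ is $f''(n):=f(n+2)-2f(n+1)+f(n)$. The norm $\|\cdot\|_p$ is the $l^p(\mathbb{Z})$ norm, taking values in $[0,\infty]$ (so it equals $\infty$ for sequences not in $l^p(\mathbb{Z})$), and $\frac1p$ is read as $0$ when $p=\infty$. *)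

theory Defs
  imports "HOL-Analysis.Analysis"
begin

definition noncentered_average :: "nat \<Rightarrow> nat \<Rightarrow> (int \<Rightarrow> real) \<Rightarrow> int \<Rightarrow> real" where
  "noncentered_average r s f n =
     1 / (real r + real s + 1) * (\<Sum>j = - int r..int s. \<bar>f (n + j)\<bar>)"

text \<open>
  The supremum is taken in the reals, so it is meaningful only when the averages at the given
  point are bounded above. This holds for every bounded function (see the lemma below), in
  particular for characteristic functions.
\<close>

definition maximal_function :: "(int \<Rightarrow> real) \<Rightarrow> int \<Rightarrow> real" where
  "maximal_function f n = (SUP (r, s) \<in> UNIV. noncentered_average r s f n)"

lemma bdd_above_noncentered_average:
  assumes "\<And>k. \<bar>f k\<bar> \<le> B"
  shows "bdd_above (range (\<lambda>(r, s). noncentered_average r s f n))"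
proof -
  have "noncentered_average r s f n \<le> B" for r s
  proof -
    have "(\<Sum>j = - int r..int s. \<bar>f (n + j)\<bar>) \<le> of_nat (card {- int r..int s}) * B"
      by (rule sum_bounded_above) (use assms in auto)
    also have "\<dots> = (real r + real s + 1) * B"
      by (simp add: nat_add_distrib)
    finally show ?thesis
      unfolding noncentered_average_def by (simp add: divide_simps mult.commute)
  qed
  then show ?thesis by (auto intro!: bdd_aboveI)
qed

definition second_derivative :: "(int \<Rightarrow> real) \<Rightarrow> int \<Rightarrow> real" where
  "second_derivative f n = f (n + 2) - 2 * f (n + 1) + f n"

text \<open>
  The norm of \<open>l\<^sup>p(\<int>)\<close> for \<open>1 \<le> p \<le> \<infinity>\<close>, with value \<open>\<infinity>\<close> outside of \<open>l\<^sup>p(\<int>)\<close>. As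
  \<open>powr\<close> is not available on \<^typ>\<open>ennreal\<close>, the \<open>p\<close>-th root of an infinite sum is given
  separately.
\<close>

definition lp_norm :: "ennreal \<Rightarrow> (int \<Rightarrow> real) \<Rightarrow> ennreal" where
  "lp_norm p f =
     (if p = \<infinity> then SUP n. ennreal \<bar>f n\<bar>
      else let S = \<Sum>\<^sub>\<infinity>n. ennreal (\<bar>f n\<bar> powr enn2real p)
           in if S = \<infinity> then \<infinity> else ennreal (enn2real S powr (1 / enn2real p)))"

text \<open>The real number \<open>1 / p\<close>, which is \<open>0\<close> for \<open>p = \<infinity>\<close>.\<close>

definition recip :: "ennreal \<Rightarrow> real" where
  "recip p = enn2real (1 / p)"

end

(*
  Write M for the maximal function of the indicator of A. At a point outside A, M is convex: an
  optimal interval either contains both neighbours, or it can be shortened by one point to reach one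
  neighbour and lengthened by one point to reach the other, and 1/s + 1/(s+2) >= 2/(s+1). At a point
  of A, M attains its maximum 1. So the signs of M'' are known, and summation by parts reduces the
  sum of |M''| over a window to the sum of |M'| over the jumps of the indicator, up to two boundary
  terms. At a jump |M'| <= 1/2 and the second derivative of the indicator does not vanish, so the
  sum is at most S + 2 <= 3 S, where S is the sum of the absolute values of that second derivative.
  This is the case p = 1. The other cases follow as |M''| <= 2 and the second derivative of the
  indicator is integer valued.
*)
theory Submission
  imports Defs
begin

section \<open>Averages over intervals and convexity at zeros\<close>

lemma noncentered_average_eq:
  "noncentered_average r s f n = (\<Sum>k = n - int r..n + int s. \<bar>f k\<bar>) / (real r + real s + 1)"
proof -
  have "(\<Sum>j = - int r..int s. \<bar>f (n + j)\<bar>) = (\<Sum>k = n - int r..n + int s. \<bar>f k\<bar>)"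
    by (rule sum.reindex_bij_witness[of _ "\<lambda>k. k - n" "\<lambda>j. n + j"]) auto
  then show ?thesis by (simp add: noncentered_average_def)
qed

text \<open>Fixing the endpoints instead of the offsets from \<open>n\<close> lets one interval
  compete at several neighbouring points.\<close>

lemma interval_average_le_maximal_function:
  assumes bnd: "\<And>k. \<bar>f k\<bar> \<le> B" and "a \<le> n" "n \<le> b"
  shows "(\<Sum>k = a..b. \<bar>f k\<bar>) / (real_of_int (b - a) + 1) \<le> maximal_function f n"
proof -
  have "noncentered_average (nat (n - a)) (nat (b - n)) f n \<le> maximal_function f n"
    unfolding maximal_function_def
    using cSUP_upper[OF UNIV_I bdd_above_noncentered_average[of f, OF bnd],
        where x = "(nat (n - a), nat (b - n))"]
    by simp
  then show ?thesis using assms by (simp add: noncentered_average_eq)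
qed

lemma maximal_function_le:
  assumes "\<And>r s. noncentered_average r s f n \<le> c"
  shows "maximal_function f n \<le> c"
  unfolding maximal_function_def by (rule cSUP_least) (use assms in auto)

lemma maximal_function_nonneg:
  assumes "\<And>k. \<bar>f k\<bar> \<le> B"
  shows "0 \<le> maximal_function f n"
  using interval_average_le_maximal_function[of f, OF assms, of n n n] by simp

text \<open>Midpoint convexity of the map sending t to c / t, at three consecutive interval
  lengths.\<close>

lemma harmonic_midpoint:
  fixes c x :: real
  assumes "0 \<le> c" "0 < x"
  shows "2 * (c / (x + 1)) \<le> c / x + c / (x + 2)"
proof -
  have "1 / x + 1 / (x + 2) - 2 / (x + 1) = 2 / (x * (x + 1) * (x + 2))"
    using assms by (simp add: divide_simps) (simp add: algebra_simps)
  also have "\<dots> \<ge> 0" using assms by simp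
  finally have "c * (2 / (x + 1)) \<le> c * (1 / x + 1 / (x + 2))"
    using assms by (intro mult_left_mono) auto
  then show ?thesis by (simp add: algebra_simps)
qed

lemma maximal_function_convex_at_zero:
  assumes bnd: "\<And>k. \<bar>f k\<bar> \<le> B" and zero: "f m = 0"
  shows "2 * maximal_function f m \<le> maximal_function f (m - 1) + maximal_function f (m + 1)"
proof -
  let ?M = "maximal_function f"
  note le = interval_average_le_maximal_function[of f, OF bnd]
  have "noncentered_average r s f m \<le> (?M (m - 1) + ?M (m + 1)) / 2" for r s
  proof -
    let ?c = "\<Sum>k = m - int r..m + int s. \<bar>f k\<bar>"
    have c: "0 \<le> ?c" by (rule sum_nonneg) auto
    consider "r = 0" "s = 0" | "r = 0" "s > 0" | "r > 0" "s = 0" | "r > 0" "s > 0"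
      by auto
    then show ?thesis
    proof cases
      case 1
      then show ?thesis
        using maximal_function_nonneg[of f, OF bnd] zero by (simp add: noncentered_average_eq)
    next
      case 2
      \<comment> \<open>Dropping \<open>m\<close> leaves the sum unchanged because
        \<open>f m = 0\<close>, and the interval of length \<open>s\<close> still reaches
        \<open>m + 1\<close>. Adding \<open>m - 1\<close> cannot lower the sum and gives length
        \<open>s + 2\<close>. The case after this one is the mirror image.\<close>
      have "{m..m + int s} = insert m {m + 1..m + int s}" using 2 by auto
      then have 1: "?c = (\<Sum>k = m + 1..m + int s. \<bar>f k\<bar>)" using 2 zero by simp
      have "?c \<le> (\<Sum>k = m - 1..m + int s. \<bar>f k\<bar>)" using 2 by (intro sum_mono2) auto
      then have "?c / (real s + 2) \<le> ?M (m - 1)"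
        using le[of "m - 1" "m - 1" "m + int s"] 2
        by (smt (verit) divide_right_mono of_int_add of_int_diff of_int_of_nat_eq of_int_1
            of_nat_0_le_iff)
      moreover have "?c / real s \<le> ?M (m + 1)"
        using le[of "m + 1" "m + 1" "m + int s"] 2 1 by simp
      ultimately show ?thesis
        using harmonic_midpoint[OF c, of "real s"] 2
        by (simp add: noncentered_average_eq mult.commute)
    next
      case 3
      have "{m - int r..m} = insert m {m - int r..m - 1}" using 3 by auto
      then have 1: "?c = (\<Sum>k = m - int r..m - 1. \<bar>f k\<bar>)" using 3 zero by simp
      have "?c \<le> (\<Sum>k = m - int r..m + 1. \<bar>f k\<bar>)" using 3 by (intro sum_mono2) auto
      then have "?c / (real r + 2) \<le> ?M (m + 1)"
        using le[of "m - int r" "m + 1" "m + 1"] 3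
        by (smt (verit) divide_right_mono of_int_add of_int_diff of_int_of_nat_eq of_int_1
            of_nat_0_le_iff)
      moreover have "?c / real r \<le> ?M (m - 1)"
        using le[of "m - int r" "m - 1" "m - 1"] 3 1 by simp
      ultimately show ?thesis
        using harmonic_midpoint[OF c, of "real r"] 3
        by (simp add: noncentered_average_eq mult.commute)
    next
      case 4
      \<comment> \<open>The interval contains both neighbours, so its average competes there
        unchanged.\<close>
      then have "?c / (real r + real s + 1) \<le> ?M (m - 1)"
          "?c / (real r + real s + 1) \<le> ?M (m + 1)"
        using le[of "m - int r" "m - 1" "m + int s"] le[of "m - int r" "m + 1" "m + int s"]
        by (simp_all add: add.commute)
      moreover have "x \<le> (y + z) / 2" if "x \<le> y" "x \<le> z" for x y z :: real
        using add_mono[OF that] by simp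
      ultimately show ?thesis unfolding noncentered_average_eq by blast
    qed
  qed
  then have "?M m \<le> (?M (m - 1) + ?M (m + 1)) / 2" by (rule maximal_function_le)
  then show ?thesis by simp
qed

section \<open>The maximal function of an indicator\<close>

context
  fixes A :: "int set"
begin

abbreviation (input) chi :: "int \<Rightarrow> real" where "chi \<equiv> indicator A"
abbreviation (input) Mchi :: "int \<Rightarrow> real" where "Mchi \<equiv> maximal_function chi"

lemma chi_bound: "\<bar>chi k\<bar> \<le> 1"
  by (simp add: indicator_def)

lemma Mchi_nonneg: "0 \<le> Mchi n"
  by (rule maximal_function_nonneg[OF chi_bound])

lemma Mchi_le_1: "Mchi n \<le> 1"
proof (rule maximal_function_le)
  fix r s
  have "(\<Sum>k = n - int r..n + int s. \<bar>chi k\<bar>) \<le> of_nat (card {n - int r..n + int s}) * 1"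
    by (rule sum_bounded_above) (rule chi_bound)
  also have "\<dots> = real r + real s + 1" by simp
  finally show "noncentered_average r s chi n \<le> 1"
    by (simp add: noncentered_average_eq)
qed

lemma Mchi_eq_1:
  assumes "n \<in> A"
  shows "Mchi n = 1"
  using interval_average_le_maximal_function[of chi, OF chi_bound, of n n n] Mchi_le_1[of n] assms
  by simp

text \<open>The competitor is the two-point interval with endpoints \<open>n\<close> and
  \<open>k\<close>.\<close>

lemma Mchi_ge_half:
  assumes "k \<in> A" "\<bar>n - k\<bar> = 1"
  shows "1 / 2 \<le> Mchi n"
proof -
  define a b where "a = min n k" and "b = max n k"
  have "b = a + 1" "k \<in> {a..b}" "a \<le> n" "n \<le> b" using assms unfolding a_def b_def by auto
  moreover have "\<bar>chi k\<bar> \<le> (\<Sum>i = a..b. \<bar>chi i\<bar>)"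
    using \<open>k \<in> {a..b}\<close> by (intro member_le_sum) auto
  ultimately show ?thesis
    using interval_average_le_maximal_function[of chi, OF chi_bound, of a n b] \<open>k \<in> A\<close> by simp
qed

lemma abs_second_derivative_Mchi_le_2: "\<bar>second_derivative Mchi n\<bar> \<le> 2"
  unfolding second_derivative_def
  using Mchi_nonneg[of n] Mchi_nonneg[of "n + 1"] Mchi_nonneg[of "n + 2"]
    Mchi_le_1[of n] Mchi_le_1[of "n + 1"] Mchi_le_1[of "n + 2"]
  by linarith

text \<open>The factor is the sign: -1 at a maximum (\<open>n + 1\<close> in \<open>A\<close>), 1 at
  a point of convexity. It is taken at \<open>n + 1\<close> because that is the centre of the second
  difference.\<close>

lemma abs_second_derivative_Mchi:
  "\<bar>second_derivative Mchi n\<bar> = (1 - 2 * chi (n + 1)) * second_derivative Mchi n"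
proof (cases "n + 1 \<in> A")
  case True
  then have "second_derivative Mchi n \<le> 0"
    unfolding second_derivative_def
    using Mchi_eq_1[OF True] Mchi_le_1[of n] Mchi_le_1[of "n + 2"] by linarith
  then show ?thesis using True by simp
next
  case False
  then have "second_derivative Mchi n \<ge> 0"
    unfolding second_derivative_def
    using maximal_function_convex_at_zero[of chi, OF chi_bound, of "n + 1"]
    by (simp add: add.assoc)
  then show ?thesis using False by simp
qed

text \<open>The second difference is the next jump minus this one. For a function with values 0 and
  1, a nonzero jump is followed by a zero or opposite jump, so nothing cancels.\<close>

lemma jump_le_second_derivative_chi:
  "\<bar>chi (n + 1) - chi n\<bar> \<le> \<bar>second_derivative chi n\<bar>"
  unfolding second_derivative_def by (auto simp: indicator_def)

text \<open>At a jump one of the two points lies in \<open>A\<close>, where \<open>Mchi\<close> is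
  1, and the other has value in [1/2, 1]. Elsewhere both sides vanish.\<close>

lemma Mchi_derivative_at_jump:
  "\<bar>(Mchi (n + 1) - Mchi n) * (chi (n + 1) - chi n)\<bar> \<le> \<bar>chi (n + 1) - chi n\<bar> / 2"
proof (cases "n \<in> A \<longleftrightarrow> n + 1 \<in> A")
  case False
  then show ?thesis
    using Mchi_eq_1[of n] Mchi_eq_1[of "n + 1"] Mchi_le_1[of n] Mchi_le_1[of "n + 1"]
      Mchi_ge_half[of n "n + 1"] Mchi_ge_half[of "n + 1" n]
    by (auto simp: indicator_def)
qed (auto simp: indicator_def)

section \<open>Summation by parts over a window\<close>

lemma sum_abs_second_derivative_Mchi_window:
  "(\<Sum>i<k. \<bar>second_derivative Mchi (a + int i)\<bar>)
     \<le> (\<Sum>i<k. \<bar>second_derivative chi (a + int i)\<bar>) + 2"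
proof -
  define D where "D i = Mchi (a + int i + 1) - Mchi (a + int i)" for i
  define c where "c i = chi (a + int i)" for i
  have by_parts: "(\<Sum>i<k. \<bar>second_derivative Mchi (a + int i)\<bar>)
      = (1 - 2 * c k) * D k - (1 - 2 * c 0) * D 0 + 2 * (\<Sum>i<k. D i * (c (Suc i) - c i))"
  proof (induction k)
    case (Suc k)
    have "\<bar>second_derivative Mchi (a + int k)\<bar> = (1 - 2 * c (Suc k)) * (D (Suc k) - D k)"
      unfolding abs_second_derivative_Mchi
      by (simp add: second_derivative_def D_def c_def algebra_simps)
    then show ?case using Suc by (simp add: algebra_simps)
  qed simp
  \<comment> \<open>The bound 1/2 cancels the factor 2 in \<open>by_parts\<close>, so the main term
    has constant 1.\<close>
  have "D i * (c (Suc i) - c i) \<le> \<bar>second_derivative chi (a + int i)\<bar> / 2" for i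
  proof -
    have "D i * (c (Suc i) - c i)
        = (Mchi (a + int i + 1) - Mchi (a + int i)) * (chi (a + int i + 1) - chi (a + int i))"
      by (simp add: D_def c_def ac_simps)
    also have "\<dots> \<le> \<bar>chi (a + int i + 1) - chi (a + int i)\<bar> / 2"
      by (rule order_trans[OF abs_ge_self Mchi_derivative_at_jump])
    also have "\<dots> \<le> \<bar>second_derivative chi (a + int i)\<bar> / 2"
      by (intro divide_right_mono jump_le_second_derivative_chi) simp
    finally show ?thesis .
  qed
  then have "(\<Sum>i<k. D i * (c (Suc i) - c i)) \<le> (\<Sum>i<k. \<bar>second_derivative chi (a + int i)\<bar> / 2)"
    by (intro sum_mono)
  \<comment> \<open>Each of the two boundary terms is a sign times a difference of values in [0, 1];
    together they give the summand 2.\<close>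
  moreover have "\<bar>(1 - 2 * c i) * D i\<bar> \<le> 1" for i
  proof -
    have "\<bar>D i\<bar> \<le> 1"
      unfolding D_def
      using Mchi_nonneg[of "a + int i"] Mchi_nonneg[of "a + int i + 1"]
        Mchi_le_1[of "a + int i"] Mchi_le_1[of "a + int i + 1"]
      by linarith
    then show ?thesis by (auto simp: c_def indicator_def)
  qed
  from this[of k] this[of 0] have "(1 - 2 * c k) * D k - (1 - 2 * c 0) * D 0 \<le> 2"
    by linarith
  ultimately show ?thesis
    unfolding by_parts by (simp flip: sum_divide_distrib)
qed

section \<open>From first powers to general exponents\<close>

lemma second_derivative_chi_zero_or_ge_1:
  "second_derivative chi n = 0 \<or> 1 \<le> \<bar>second_derivative chi n\<bar>"
  unfolding second_derivative_def by (auto simp: indicator_def)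

text \<open>This degenerate case is treated apart: a vanishing right-hand side cannot absorb the
  additive 2. Without jumps \<open>chi\<close> is constant, and then the averages do not depend on
  the point.\<close>

lemma second_derivative_Mchi_eq_0:
  assumes "\<And>n. second_derivative chi n = 0"
  shows "second_derivative Mchi n = 0"
proof -
  have step: "chi (n + 1) = chi n" for n
    using jump_le_second_derivative_chi[of n] assms[of n] by simp
  have const: "chi n = chi 0" for n
  proof (induction n rule: int_induct[of _ 0])
    case (step2 i)
    then show ?case using step[of "i - 1"] by simp
  qed (simp_all add: step)
  then have "chi = (\<lambda>_. chi 0)" by (rule ext)
  then obtain c where "chi = (\<lambda>_. c)" by blast
  then show ?thesis
    by (simp add: second_derivative_def maximal_function_def noncentered_average_def)
qed

text \<open>Working in \<open>ennreal\<close> covers infinite sums as well, so \<open>A\<close> may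
  have infinitely many jumps.\<close>

lemma powr_sum_second_derivative_le:
  assumes q: "1 \<le> q"
  shows "(\<Sum>\<^sub>\<infinity>n. ennreal (\<bar>second_derivative Mchi n\<bar> powr q))
     \<le> ennreal (2 powr (q - 1) * 3) * (\<Sum>\<^sub>\<infinity>n. ennreal (\<bar>second_derivative chi n\<bar> powr q))"
    (is "?L \<le> _ * ?S")
proof (cases "\<forall>n. second_derivative chi n = 0")
  case True
  then show ?thesis using second_derivative_Mchi_eq_0 by simp
next
  case False
  then obtain m where m: "1 \<le> \<bar>second_derivative chi m\<bar>"
    using second_derivative_chi_zero_or_ge_1 by blast
  let ?g = "\<lambda>n. \<bar>second_derivative chi n\<bar> powr q"
  have sum_le: "(\<Sum>n\<in>F. ennreal (?g n)) \<le> ?S" if "finite F" for F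
    by (subst nonneg_infsum_complete) (use that in \<open>auto intro: SUP_upper\<close>)
  have "1 \<le> ?g m" using m q by (simp add: ge_one_powr_ge_zero)
  then have S1: "1 \<le> ?S"
    using order_trans[OF _ sum_le[of "{m}"], of 1] by simp
  show ?thesis
  proof (rule infsum_le_finite_sums)
    show "(\<lambda>n. ennreal (\<bar>second_derivative Mchi n\<bar> powr q)) summable_on UNIV"
      by (rule nonneg_summable_on_complete) auto
    fix F :: "int set"
    assume "finite F"
    obtain N where N: "\<And>n. n \<in> F \<Longrightarrow> \<bar>n\<bar> \<le> N"
      using \<open>finite F\<close> by (metis finite_imageI Max_ge imageI)
    \<comment> \<open>Summation by parts needs consecutive indices, so \<open>F\<close> is enlarged
      to the integers from \<open>- N\<close> to \<open>N\<close>.\<close>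
    define a k where "a = - N" and "k = nat (2 * N + 1)"
    let ?W = "(\<lambda>i. a + int i) ` {..<k}"
    have FW: "F \<subseteq> ?W"
    proof
      fix n assume "n \<in> F"
      from N[OF this] have "n = a + int (nat (n + N))" "nat (n + N) < k"
        unfolding a_def k_def by auto
      then show "n \<in> ?W" by blast
    qed
    have inj: "inj_on (\<lambda>i. a + int i) {..<k}" by (simp add: inj_on_def)
    \<comment> \<open>One factor is kept for the window estimate; the remaining power
      \<open>q - 1\<close> is bounded through the uniform bound 2.\<close>
    have pow_le: "\<bar>second_derivative Mchi n\<bar> powr q
        \<le> 2 powr (q - 1) * \<bar>second_derivative Mchi n\<bar>" for n
    proof (cases "second_derivative Mchi n = 0")
      case False
      let ?x = "\<bar>second_derivative Mchi n\<bar>"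
      have "?x powr q = ?x powr (q - 1) * ?x"
        using False by (simp add: powr_diff)
      also have "\<dots> \<le> 2 powr (q - 1) * ?x"
        using abs_second_derivative_Mchi_le_2 q by (intro mult_right_mono powr_mono2) auto
      finally show ?thesis .
    qed simp
    \<comment> \<open>Raising to a power \<open>q \<ge> 1\<close> does not decrease 0 or a number
      that is at least 1.\<close>
    have le_pow: "\<bar>second_derivative chi n\<bar> \<le> ?g n" for n
      using second_derivative_chi_zero_or_ge_1[of n] powr_mono[OF q, of "\<bar>second_derivative chi n\<bar>"]
      by auto
    have "(\<Sum>n\<in>F. \<bar>second_derivative Mchi n\<bar> powr q)
        \<le> (\<Sum>n\<in>?W. \<bar>second_derivative Mchi n\<bar> powr q)"
      using FW by (intro sum_mono2) auto
    also have "\<dots> \<le> (\<Sum>n\<in>?W. 2 powr (q - 1) * \<bar>second_derivative Mchi n\<bar>)"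
      by (intro sum_mono pow_le)
    also have "\<dots> = 2 powr (q - 1) * (\<Sum>n\<in>?W. \<bar>second_derivative Mchi n\<bar>)"
      by (simp add: sum_distrib_left)
    also have "(\<Sum>n\<in>?W. \<bar>second_derivative Mchi n\<bar>) \<le> (\<Sum>n\<in>?W. \<bar>second_derivative chi n\<bar>) + 2"
      using sum_abs_second_derivative_Mchi_window[where a = a and k = k]
      by (simp add: sum.reindex[OF inj] o_def)
    also have "(\<Sum>n\<in>?W. \<bar>second_derivative chi n\<bar>) \<le> (\<Sum>n\<in>?W. ?g n)"
      by (intro sum_mono le_pow)
    finally have real_le: "(\<Sum>n\<in>F. \<bar>second_derivative Mchi n\<bar> powr q)
        \<le> 2 powr (q - 1) * ((\<Sum>n\<in>?W. ?g n) + 2)"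
      by simp
    have "(\<Sum>n\<in>F. ennreal (\<bar>second_derivative Mchi n\<bar> powr q))
        = ennreal (\<Sum>n\<in>F. \<bar>second_derivative Mchi n\<bar> powr q)"
      by (rule sum_ennreal) simp
    also have "\<dots> \<le> ennreal (2 powr (q - 1) * ((\<Sum>n\<in>?W. ?g n) + 2))"
      using real_le by (rule ennreal_leI)
    also have "\<dots> = ennreal (2 powr (q - 1)) * ((\<Sum>n\<in>?W. ennreal (?g n)) + 2)"
      by (simp add: ennreal_mult ennreal_plus sum_nonneg)
    \<comment> \<open>Here \<open>1 \<le> ?S\<close> absorbs the boundary contribution and produces
      the constant 3.\<close>
    also have "\<dots> \<le> ennreal (2 powr (q - 1)) * (?S + 2 * ?S)"
      using sum_le[of ?W] mult_left_mono[OF S1, of 2]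
      by (intro mult_left_mono add_mono) auto
    also have "?S + 2 * ?S = 3 * ?S"
      using distrib_right[of 1 2 ?S] by simp
    also have "ennreal (2 powr (q - 1)) * (3 * ?S) = ennreal (2 powr (q - 1) * 3) * ?S"
      by (simp add: ennreal_mult mult.assoc)
    finally show "(\<Sum>n\<in>F. ennreal (\<bar>second_derivative Mchi n\<bar> powr q))
        \<le> ennreal (2 powr (q - 1) * 3) * ?S" .
  qed
qed

text \<open>Unless \<open>chi\<close> has zero second derivative everywhere, the supremum on the
  right is at least 1, so the uniform bound 2 suffices.\<close>

lemma sup_second_derivative_le:
  "(SUP n. ennreal \<bar>second_derivative Mchi n\<bar>) \<le> 2 * (SUP n. ennreal \<bar>second_derivative chi n\<bar>)"
proof (cases "\<forall>n. second_derivative chi n = 0")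
  case True
  then show ?thesis using second_derivative_Mchi_eq_0 by simp
next
  case False
  then obtain m where "1 \<le> \<bar>second_derivative chi m\<bar>"
    using second_derivative_chi_zero_or_ge_1 by blast
  then have "1 \<le> ennreal \<bar>second_derivative chi m\<bar>" by simp
  also have "\<dots> \<le> (SUP n. ennreal \<bar>second_derivative chi n\<bar>)" by (rule SUP_upper) simp
  finally have "2 * 1 \<le> 2 * (SUP n. ennreal \<bar>second_derivative chi n\<bar>)"
    by (rule mult_left_mono) simp
  moreover have "ennreal \<bar>second_derivative Mchi n\<bar> \<le> 2" for n
    using ennreal_leI[OF abs_second_derivative_Mchi_le_2[of n]] by simp
  ultimately show ?thesis by (intro SUP_least) (metis mult.right_neutral order_trans)
qed

end

section \<open>Passing to the norms\<close>

lemma recip_eq: "1 \<le> p \<Longrightarrow> recip p = 1 / enn2real p"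
  unfolding recip_def by (cases p) (auto simp: divide_ennreal simp flip: ennreal_1)

theorem theorem1:
  fixes A :: "int set" and p :: ennreal
  assumes "1 \<le> p"
  shows "lp_norm p (second_derivative (maximal_function (indicator A)))
           \<le> ennreal (2 powr (1 - recip p) * 3 powr recip p)
               * lp_norm p (second_derivative (indicator A))"
proof (cases "p = \<infinity>")
  case True
  then show ?thesis
    using sup_second_derivative_le[of A] by (simp add: lp_norm_def recip_def)
next
  case False
  define q where "q = enn2real p"
  have q: "1 \<le> q"
    using enn2real_mono[OF assms] False unfolding q_def by (simp add: less_top)
  let ?L = "\<Sum>\<^sub>\<infinity>n. ennreal (\<bar>second_derivative (maximal_function (indicator A)) n\<bar> powr q)"
  let ?S = "\<Sum>\<^sub>\<infinity>n. ennreal (\<bar>second_derivative (indicator A) n\<bar> powr q)"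
  have le: "?L \<le> ennreal (2 powr (q - 1) * 3) * ?S"
    by (rule powr_sum_second_derivative_le[OF q])
  have recip: "recip p = 1 / q" unfolding q_def by (rule recip_eq[OF assms])
  show ?thesis
  proof (cases "?S = \<infinity>")
    case True
    then have "lp_norm p (second_derivative (indicator A)) = \<infinity>"
      using False by (simp add: lp_norm_def q_def)
    then show ?thesis by (simp add: ennreal_mult_top)
  next
    case S: False
    then have fin: "ennreal (2 powr (q - 1) * 3) * ?S < \<infinity>"
      by (simp add: ennreal_mult_less_top less_top)
    \<comment> \<open>Finiteness selects the root branch of \<open>lp_norm\<close>;
      \<open>enn2real\<close> would send an infinite sum to 0.\<close>
    with le have L: "?L \<noteq> \<infinity>" by auto
    have "enn2real ?L \<le> 2 powr (q - 1) * 3 * enn2real ?S"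
      using enn2real_mono[OF le] fin by (simp add: enn2real_mult)
    then have "enn2real ?L powr (1 / q) \<le> (2 powr (q - 1) * 3 * enn2real ?S) powr (1 / q)"
      using q by (intro powr_mono2) auto
    \<comment> \<open>The constant of the theorem is the \<open>q\<close>-th root of
      \<open>2 powr (q - 1) * 3\<close>.\<close>
    also have "\<dots> = 2 powr (1 - 1 / q) * 3 powr (1 / q) * enn2real ?S powr (1 / q)"
      using q by (simp add: powr_mult powr_powr diff_divide_distrib)
    finally have "ennreal (enn2real ?L powr (1 / q))
        \<le> ennreal (2 powr (1 - 1 / q) * 3 powr (1 / q)) * ennreal (enn2real ?S powr (1 / q))"
      by (simp add: ennreal_leI flip: ennreal_mult)
    then show ?thesis
      using False S L by (simp add: lp_norm_def recip flip: q_def)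
  qed
qed

end
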